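(* Let $(\boldsymbol g_t)_{t\ge 1}\subset\mathbb R^d$ be any sequence with $\|\boldsymbol g_1\|>0$, and let $(h_t)_{t\ge1}$ be hints such that $(h_t)$ is non-decreasing, $h_t\ge L_t:=\max_{s\le t}\|\boldsymbol g_s\|$ for all $t\ge 1$, and the hints are multiplied by $c$ whenever the sequence $(\boldsymbol g_s)$ is multiplied by a factor $c>0$. Let $(\widehat{\boldsymbol w}_t)_{t\ge 1}$ be the outputs of FreeGrad and let $(\Phi_t)_{t\ge0}$ be the potential, both defined in the context. Then for all $T\ge 1$, $$\Phi_T\le \Phi_{T-1}\le\dots\le\Phi_0=h_1 .$$
   Context: $\|\cdot\|$ is the Euclidean norm on $\mathbb R^d$. In each round $t\ge1$ the learner sees a hint $h_t$, outputs $\widehat{\boldsymbol w}_t\in\mathbb R^d$ depending on $(\boldsymbol g_s)_{s<t}$ and $(h_s)_{s\le t}$, and then $\boldsymbol g_t\in\mathbb R^d$ is revealed. Define, for $t\ge 0$, $$S_t:=\sum_{s=1}^t\langle \boldsymbol g_s,\widehat{\boldsymbol w}_s\rangle,\quad \mathbf G_t:=\sum_{s=1}^t\boldsymbol g_s,\quad V_t:=h_1^2+\sum_{s=1}^t\|\boldsymbol g_s\|^2,$$ $$\Phi_t:=S_t+\frac{h_1^2}{\sqrt{V_t}}\exp\left(\frac{\|\mathbf G_t\|^2}{2V_t+2h_t\|\mathbf G_t\|}\right)$$ (for $t=0$ we have $\mathbf G_0=\boldsymbol 0$, so the value of $h_0$ is immaterial). FreeGrad outputs in round $t\ge 1$: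 $$\widehat{\boldsymbol w}_t:=-\mathbf G_{t-1}\cdot\frac{(2V_{t-1}+h_t\|\mathbf G_{t-1}\|)\,h_1^2}{2(V_{t-1}+h_t\|\mathbf G_{t-1}\|)^2\sqrt{V_{t-1}}}\cdot\exp\left(\frac{\|\mathbf G_{t-1}\|^2}{2V_{t-1}+2h_t\|\mathbf G_{t-1}\|}\right).$$ *)

theory Defs
  imports "HOL-Analysis.Analysis"
begin

text \<open>
  Sequences of gradients, hints and outputs are functions on \<open>nat\<close> indexed by rounds \<open>t \<ge> 1\<close>.
  The value at index 0 is junk; only \<open>h 0\<close> is ever referenced, in the potential at time 0,
  where it is multiplied by the norm of the empty sum.
\<close>

definition max_norm :: "(nat \<Rightarrow> real ^ 'd) \<Rightarrow> nat \<Rightarrow> real" where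
  "max_norm g t = Max ((\<lambda>s. norm (g s)) ` {1..t})"

definition cum_loss :: "(nat \<Rightarrow> real ^ 'd) \<Rightarrow> (nat \<Rightarrow> real ^ 'd) \<Rightarrow> nat \<Rightarrow> real" where
  "cum_loss g w t = (\<Sum>s=1..t. g s \<bullet> w s)"

definition grad_sum :: "(nat \<Rightarrow> real ^ 'd) \<Rightarrow> nat \<Rightarrow> real ^ 'd" where
  "grad_sum g t = (\<Sum>s=1..t. g s)"

definition grad_var :: "(nat \<Rightarrow> real ^ 'd) \<Rightarrow> (nat \<Rightarrow> real) \<Rightarrow> nat \<Rightarrow> real" where
  "grad_var g h t = (h 1)\<^sup>2 + (\<Sum>s=1..t. (norm (g s))\<^sup>2)"

definition potential ::
    "(nat \<Rightarrow> real ^ 'd) \<Rightarrow> (nat \<Rightarrow> real) \<Rightarrow> (nat \<Rightarrow> real ^ 'd) \<Rightarrow> nat \<Rightarrow> real" where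
  "potential g h w t =
     (let G = norm (grad_sum g t); V = grad_var g h t
      in cum_loss g w t + (h 1)\<^sup>2 / sqrt V * exp (G\<^sup>2 / (2 * V + 2 * h t * G)))"

text \<open>The output in round \<open>t \<ge> 1\<close>; it depends only on \<open>g 1, \<dots>, g (t - 1)\<close> and \<open>h 1, h t\<close>.\<close>

definition freegrad :: "(nat \<Rightarrow> real ^ 'd) \<Rightarrow> (nat \<Rightarrow> real) \<Rightarrow> nat \<Rightarrow> real ^ 'd" where
  "freegrad g h t =
     (let G = norm (grad_sum g (t - 1)); V = grad_var g h (t - 1)
      in - (((2 * V + h t * G) * (h 1)\<^sup>2 / (2 * (V + h t * G)\<^sup>2 * sqrt V)
            * exp (G\<^sup>2 / (2 * V + 2 * h t * G))) *\<^sub>R grad_sum g (t - 1)))"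

text \<open>
  The hints are produced by a map \<open>H\<close> from gradient sequences to hint sequences, so that one can
  speak of how they respond to rescaling a given sequence \<open>g\<close>.
\<close>

definition hints_scale_with ::
    "((nat \<Rightarrow> real ^ 'd) \<Rightarrow> nat \<Rightarrow> real) \<Rightarrow> (nat \<Rightarrow> real ^ 'd) \<Rightarrow> bool" where
  "hints_scale_with H g \<longleftrightarrow> (\<forall>c>0. \<forall>t\<ge>1. H (\<lambda>s. c *\<^sub>R g s) t = c * H g t)"

end

theory Submission
  imports Defs
begin

text \<open>
  With \<open>G\<close>, \<open>V\<close>, \<open>k\<close> the gradient sum, the variance and the hint entering a round, the prediction is
  \<open>- h\<^sub>1\<^sup>2\<close> times the gradient in \<open>G\<close> of \<open>F(G, V) = exp (\<parallel>G\<parallel>\<^sup>2 / (2 V + 2 k \<parallel>G\<parallel>)) / sqrt V\<close>, so the claim is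
  \<open>F(G + v, V + \<parallel>v\<parallel>\<^sup>2) \<le> F(G, V) + v \<bullet> \<nabla>F(G, V)\<close> for \<open>\<parallel>v\<parallel> \<le> k\<close>. Both sides are invariant under rescaling
  up to a common factor, so let \<open>k = 1\<close>, and put \<open>x = \<parallel>G\<parallel>\<close>, \<open>s = \<parallel>v\<parallel>\<close>, \<open>y = \<parallel>G + v\<parallel>\<close>, with \<open>u\<close> the component of
  \<open>v\<close> along \<open>G\<close>. After taking logarithms, the exponent \<open>y\<^sup>2 / (2 (W + y))\<close> is a concave function of \<open>y\<^sup>2\<close>, hence
  lies below its tangent at any \<open>z \<ge> 0\<close>, which is linear in \<open>u\<close>. The tangent point \<open>z = x\<close> works for \<open>u \<ge> 0\<close>, and
  \<open>z = max 0 (x - s\<^sup>2)\<close> for \<open>u \<le> 0\<close>.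
\<close>

section \<open>Scalar inequalities for the logarithm, the exponential and the tangent\<close>

text \<open>The derivative is \<open>z\<^sup>2 / (1 + z)\<close>. Comparison with the value at
  \<open>0\<close> makes the quadratic Taylor polynomial of the logarithm a lower bound to the right
  of \<open>0\<close> and an upper bound to the left.\<close>

lemma ln_one_plus_quadratic_mono:
  fixes a b :: real
  assumes "-1 < a" "a \<le> b"
  shows "ln (1 + a) - a + a\<^sup>2 / 2 \<le> ln (1 + b) - b + b\<^sup>2 / 2"
proof (rule DERIV_nonneg_imp_nondecreasing[OF assms(2)])
  fix z :: real
  assume "a \<le> z" "z \<le> b"
  hence z: "1 + z > 0" using assms by linarith
  have "((\<lambda>z. ln (1 + z) - z + z\<^sup>2 / 2) has_real_derivative z\<^sup>2 / (1 + z)) (at z)"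
    using z by (auto intro!: derivative_eq_intros simp: divide_simps power2_eq_square algebra_simps)
  thus "\<exists>y. ((\<lambda>z. ln (1 + z) - z + z\<^sup>2 / 2) has_real_derivative y) (at z) \<and> 0 \<le> y"
    using z by (intro exI[of _ "z\<^sup>2 / (1 + z)"]) auto
qed

lemma exp_minus_le_quadratic:
  fixes t :: real
  assumes "0 \<le> t"
  shows "exp (- t) \<le> 1 - t + t\<^sup>2 / 2"
proof -
  have "1 - 0 + 0\<^sup>2 / 2 - exp (- 0) \<le> 1 - t + t\<^sup>2 / 2 - exp (- t)"
  proof (rule DERIV_nonneg_imp_nondecreasing[OF assms])
    fix z :: real
    have "((\<lambda>t. 1 - t + t\<^sup>2 / 2 - exp (- t)) has_real_derivative (-1 + z + exp (- z))) (at z)"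
      by (auto intro!: derivative_eq_intros)
    thus "\<exists>y. ((\<lambda>t. 1 - t + t\<^sup>2 / 2 - exp (- t)) has_real_derivative y) (at z) \<and> 0 \<le> y"
      using exp_ge_add_one_self[of "- z"] by (intro exI[of _ "-1 + z + exp (- z)"]) auto
  qed
  thus ?thesis by simp
qed

text \<open>The right side is the tangent at \<open>y = z\<close> of the exponent as a function of
  \<open>y\<^sup>2\<close>, with slope \<open>(2 * W + z) / (4 * (W + z)\<^sup>2)\<close>; the gap
  has the factor \<open>(y - z)\<^sup>2\<close>.\<close>

lemma tangent_bound:
  fixes y z W :: real
  assumes "0 \<le> y" "0 \<le> z" "0 < W"
  shows "y\<^sup>2 / (2 * (W + y)) \<le> (z ^ 3 + y\<^sup>2 * (2 * W + z)) / (4 * (W + z)\<^sup>2)"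
proof -
  have "(z ^ 3 + y\<^sup>2 * (2 * W + z)) / (4 * (W + z)\<^sup>2) - y\<^sup>2 / (2 * (W + y))
      = (y - z)\<^sup>2 * (W * (z + 2 * y) + y * z) / (4 * (W + z)\<^sup>2 * (W + y))"
    using assms by (simp add: divide_simps) (simp add: algebra_simps power2_eq_square power3_eq_cube)
  also have "\<dots> \<ge> 0" using assms by (intro divide_nonneg_nonneg mult_nonneg_nonneg add_nonneg_nonneg) auto
  finally show ?thesis by simp
qed

section \<open>One round with unit hint, in scalar coordinates\<close>

text \<open>\<open>p\<close> is the derivative of \<open>x\<^sup>2 / (2 (V + x))\<close> in \<open>x\<close>.\<close>

locale freegrad_step =
  fixes V x s u y W p a :: real
  assumes V: "0 < V" and x: "0 \<le> x" and s: "0 \<le> s" "s \<le> 1" and u: "\<bar>u\<bar> \<le> s"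
    and y: "0 \<le> y" "y\<^sup>2 = x\<^sup>2 + 2 * x * u + s\<^sup>2"
  defines "W \<equiv> V + s\<^sup>2"
    and "p \<equiv> x * (2 * V + x) / (2 * (V + x)\<^sup>2)"
    and "a \<equiv> x / (V + x)"
begin

lemma W: "0 < W" "V \<le> W"
  using V by (auto simp: W_def intro: add_pos_nonneg)

lemma a: "0 \<le> a" "a < 1"
  using V x by (auto simp: a_def)

text \<open>Completing the square gives \<open>(1 - (1 - a)\<^sup>2) / 2\<close>, increasing for
  \<open>a\<close> up to \<open>1\<close>, so slopes at different variances compare through
  \<open>x / (V + x)\<close>.\<close>

lemma p_eq: "p = a - a\<^sup>2 / 2"
  using V x unfolding p_def a_def
  by (simp add: divide_simps) (simp add: algebra_simps power2_eq_square)

lemma p: "0 \<le> p" "p \<le> a" "p < 1 / 2"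
proof -
  show "0 \<le> p" using V x by (simp add: p_def)
  show "p \<le> a" by (simp add: p_eq)
  have "1 / 2 - p = (1 - a)\<^sup>2 / 2" by (simp add: p_eq power2_eq_square field_simps)
  also have "\<dots> > 0" using a by simp
  finally show "p < 1 / 2" by simp
qed

lemma up: "-1 < u * p"
proof -
  have "\<bar>u * p\<bar> \<le> 1 * (1 / 2)" unfolding abs_mult
    using u s p by (intro mult_mono) auto
  thus ?thesis by linarith
qed

lemma s2: "s\<^sup>2 \<le> 1" "s ^ 4 \<le> s\<^sup>2"
proof -
  show "s\<^sup>2 \<le> 1" using s by (simp add: power_le_one)
  show "s ^ 4 \<le> s\<^sup>2" using s by (intro power_decreasing) auto
qed

lemma ln_ratio_ge: "s\<^sup>2 / W \<le> ln (W / V)"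
proof -
  have "ln (V / W) \<le> V / W - 1" using V W by (intro ln_le_minus_one) auto
  also have "\<dots> = - (s\<^sup>2 / W)" using W by (simp add: W_def field_simps)
  finally show ?thesis using V W by (simp add: ln_div)
qed

text \<open>Since \<open>W + x \<ge> V + 2 * x\<close>, the ratio \<open>x / (W + x)\<close> is at
  most \<open>a / (1 + a)\<close>, which leaves a rational inequality in \<open>a\<close> alone. The
  surplus \<open>p\<^sup>2 / 2\<close> is to pay for the second-order loss in
  \<open>ln (1 + u * p)\<close>.\<close>

lemma slope_gap:
  assumes "x \<le> s\<^sup>2"
  shows "x * (2 * W + x) / (2 * (W + x)\<^sup>2) + p\<^sup>2 / 2 \<le> p"
proof -
  define b where "b = x / (W + x)"
  define c where "c = a / (1 + a)"
  have "b \<le> x / (V + x + x)"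
    unfolding b_def using V x assms by (intro divide_left_mono) (auto simp: W_def intro!: mult_pos_pos add_pos_nonneg)
  also have "\<dots> = c" using V x unfolding a_def c_def by (simp add: divide_simps)
  finally have bc: "b \<le> c" .
  have c: "c \<le> 1" using a by (simp add: c_def divide_simps)
  have "x * (2 * W + x) / (2 * (W + x)\<^sup>2) = b - b\<^sup>2 / 2"
    using W x unfolding b_def by (simp add: divide_simps) (simp add: algebra_simps power2_eq_square)
  also have "\<dots> \<le> c - c\<^sup>2 / 2"
  proof -
    have "(c - c\<^sup>2 / 2) - (b - b\<^sup>2 / 2) = (c - b) * (1 - (b + c) / 2)"
      by (simp add: field_simps power2_eq_square)
    also have "\<dots> \<ge> 0" using bc c by (intro mult_nonneg_nonneg) auto
    finally show ?thesis by simp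
  qed
  also have "\<dots> + p\<^sup>2 / 2 \<le> p"
  proof -
    have ne: "1 + a \<noteq> 0" using a by linarith
    have "p - p\<^sup>2 / 2 - (c - c\<^sup>2 / 2) = a\<^sup>2 * (1 - a) * (4 - a\<^sup>2 + a ^ 3) / (8 * (1 + a)\<^sup>2)"
      unfolding p_eq c_def using ne
      by (simp add: divide_simps) (simp add: algebra_simps power2_eq_square power3_eq_cube)
    also have "\<dots> \<ge> 0"
    proof -
      have "a\<^sup>2 \<le> 1" "0 \<le> a ^ 3" using a by (auto simp: power_le_one)
      thus ?thesis using a by (intro divide_nonneg_nonneg mult_nonneg_nonneg) auto
    qed
    finally show ?thesis by simp
  qed
  finally show ?thesis by simp
qed

text \<open>Here \<open>q\<close> is \<open>p\<close> with \<open>W\<close> in place of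
  \<open>V\<close>. The loss \<open>u\<^sup>2 * p\<^sup>2 / 2\<close> from the logarithm is paid by
  \<open>p - q\<close> if \<open>x \<le> s\<^sup>2\<close>, and by the growth of the variance
  otherwise.\<close>

lemma step_nonneg:
  assumes "0 \<le> u"
  shows "y\<^sup>2 / (2 * (W + y)) \<le> x\<^sup>2 / (2 * (V + x)) + ln (1 + u * p) + ln (W / V) / 2"
proof -
  define q where "q = x * (2 * W + x) / (2 * (W + x)\<^sup>2)"
  have us: "u \<le> s" "u\<^sup>2 \<le> s\<^sup>2" using u assms by (auto intro: power_mono)
  have ln1: "u * p - u\<^sup>2 * p\<^sup>2 / 2 \<le> ln (1 + u * p)"
    using ln_one_plus_quadratic_mono[of 0 "u * p"] assms p by (simp add: power_mult_distrib)
  have tan: "y\<^sup>2 / (2 * (W + y)) \<le> x\<^sup>2 / (2 * (W + x)) + u * q + s\<^sup>2 * (2 * W + x) / (4 * (W + x)\<^sup>2)"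
  proof -
    have "(x ^ 3 + y\<^sup>2 * (2 * W + x)) / (4 * (W + x)\<^sup>2)
       = x\<^sup>2 / (2 * (W + x)) + u * q + s\<^sup>2 * (2 * W + x) / (4 * (W + x)\<^sup>2)"
      unfolding q_def y(2) using W x
      by (simp add: divide_simps) (simp add: algebra_simps power2_eq_square power3_eq_cube)
    thus ?thesis using tangent_bound[OF y(1) x W(1)] by simp
  qed
  \<comment> \<open>A lower bound for what half of \<open>ln (W / V)\<close> leaves after paying the
    last term of the tangent.\<close>
  have gain: "s\<^sup>2 * x / (2 * W * (W + x)) \<le> s\<^sup>2 / (2 * W) - s\<^sup>2 * (2 * W + x) / (4 * (W + x)\<^sup>2)"
  proof -
    have "s\<^sup>2 / (2 * W) - s\<^sup>2 * (2 * W + x) / (4 * (W + x)\<^sup>2) - s\<^sup>2 * x / (2 * W * (W + x))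
        = s\<^sup>2 * (W * x) / (4 * W * (W + x)\<^sup>2)"
      using W x by (simp add: divide_simps) (simp add: algebra_simps power2_eq_square)
    also have "\<dots> \<ge> 0" using W x by (intro divide_nonneg_nonneg mult_nonneg_nonneg) auto
    finally show ?thesis by simp
  qed
  have "x\<^sup>2 / (2 * (W + x)) + u * q + s\<^sup>2 * (2 * W + x) / (4 * (W + x)\<^sup>2)
     \<le> x\<^sup>2 / (2 * (V + x)) + (u * p - u\<^sup>2 * p\<^sup>2 / 2) + s\<^sup>2 / (2 * W)"
  proof (cases "x \<le> s\<^sup>2")
    case True
    have "u\<^sup>2 * p\<^sup>2 / 2 \<le> u * p\<^sup>2 / 2"
      using assms us s by (intro divide_right_mono mult_right_mono) (auto simp: power2_eq_square mult_left_le)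
    moreover have "u * (q + p\<^sup>2 / 2) \<le> u * p"
      using slope_gap[OF True] assms unfolding q_def by (intro mult_left_mono)
    moreover have "x\<^sup>2 / (2 * (W + x)) \<le> x\<^sup>2 / (2 * (V + x))"
      using V W x by (intro divide_left_mono) (auto intro!: mult_pos_pos add_pos_nonneg)
    moreover have "0 \<le> s\<^sup>2 * x / (2 * W * (W + x))" using W x by simp
    ultimately show ?thesis using gain by (simp add: algebra_simps)
  next
    case False
    have "q \<le> p"
    proof -
      define b where "b = x / (W + x)"
      have "b \<le> a" unfolding a_def b_def
        using V W x by (intro divide_left_mono) (auto intro!: mult_pos_pos add_pos_nonneg)
      have "q = b - b\<^sup>2 / 2"
        using W x unfolding b_def q_def by (simp add: divide_simps) (simp add: algebra_simps power2_eq_square)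
      hence "p - q = (a - b) * (1 - (a + b) / 2)"
        unfolding p_eq by (simp add: field_simps power2_eq_square)
      also have "\<dots> \<ge> 0" using \<open>b \<le> a\<close> a by (intro mult_nonneg_nonneg) auto
      finally show ?thesis by simp
    qed
    hence uq: "u * q \<le> u * p" using assms by (intro mult_left_mono)
    have up2: "u\<^sup>2 * p\<^sup>2 \<le> s\<^sup>2 * a\<^sup>2"
      using us(1) assms p by (intro mult_mono power_mono) auto
    \<comment> \<open>The leftover from \<open>gain\<close> plus the drop of the exponent as
      \<open>V\<close> grows to \<open>W\<close>, less the bound \<open>up2\<close> on the loss. It
      is nonnegative because \<open>s\<^sup>2 \<le> 1\<close> and
      \<open>s ^ 4 \<le> s\<^sup>2 < x\<close>.\<close>
    have "s\<^sup>2 * x / (2 * W * (W + x)) + x\<^sup>2 / (2 * (V + x)) - x\<^sup>2 / (2 * (W + x)) - s\<^sup>2 * a\<^sup>2 / 2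
       = s\<^sup>2 * x * ((V + x)\<^sup>2 - x * s\<^sup>2 * W) / (2 * W * (W + x) * (V + x)\<^sup>2)"
    proof -
      have ne: "W \<noteq> 0" "W + x \<noteq> 0" "V + x \<noteq> 0" using V W x by auto
      have s2: "s\<^sup>2 = W - V" by (simp add: W_def)
      show ?thesis unfolding a_def s2 using ne
        by (simp add: divide_simps) (simp add: algebra_simps power2_eq_square)
    qed
    also have "\<dots> \<ge> 0"
    proof -
      have "x * s\<^sup>2 * W = x * s\<^sup>2 * V + x * s ^ 4" by (simp add: W_def algebra_simps power_numeral_reduce)
      also have "\<dots> \<le> x * 1 * V + x * x"
        using V x s2 False by (intro add_mono mult_left_mono mult_right_mono) auto
      also have "\<dots> \<le> (V + x)\<^sup>2" using V x by (simp add: power2_eq_square algebra_simps)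
      finally show ?thesis using V W x by (intro divide_nonneg_nonneg mult_nonneg_nonneg) auto
    qed
    finally show ?thesis using gain uq up2 by linarith
  qed
  thus ?thesis using tan ln1 ln_ratio_ge by simp
qed

text \<open>The tangent point is \<open>0\<close>. Concavity replaces \<open>ln (1 - v * p)\<close>
  by \<open>v * ln (1 - p)\<close>, so what must be nonnegative is affine in \<open>v\<close>: at
  \<open>v = 0\<close> this is \<open>ln_ratio_ge\<close>, at \<open>v = 1\<close> it is
  \<open>0 \<le> ln (1 - p) + k\<close>.\<close>

lemma step_nonpos_small:
  assumes "u \<le> 0" "x \<le> s\<^sup>2"
  shows "y\<^sup>2 / (2 * (W + y)) \<le> x\<^sup>2 / (2 * (V + x)) + ln (1 + u * p) + ln (W / V) / 2"
proof -
  define v where "v = - u"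
  define k where "k = (x - s\<^sup>2 / 2) / W + ln (W / V) / 2"
  have v: "0 \<le> v" "v \<le> 1" using assms u s by (auto simp: v_def)
  have "y\<^sup>2 / (2 * (W + y)) \<le> y\<^sup>2 / (2 * W)"
    using W y(1) by (intro divide_left_mono) (auto intro!: mult_pos_pos add_pos_nonneg)
  also have "\<dots> = x\<^sup>2 / (2 * W) - v * (x / W) + s\<^sup>2 / (2 * W)"
    using W unfolding y(2) v_def by (simp add: field_simps)
  also have "x\<^sup>2 / (2 * W) \<le> x\<^sup>2 / (2 * (V + x))"
    using V W x assms by (intro divide_left_mono) (auto simp: W_def intro!: mult_pos_pos add_pos_nonneg)
  finally have tan: "y\<^sup>2 / (2 * (W + y)) \<le> x\<^sup>2 / (2 * (V + x)) - v * (x / W) + s\<^sup>2 / (2 * W)" by simp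
  have "v * ln (1 - p) \<le> ln (1 - v * p)"
    using concave_onD[OF ln_concave, of v 1 "1 - p"] v p by (simp add: algebra_simps)
  moreover have "0 \<le> ln (1 - p) + k"
  proof -
    define c where "c = x / V"
    have c: "0 \<le> c" using V x by (simp add: c_def)
    \<comment> \<open>\<open>k\<close> as a function of \<open>W\<close> is minimal at \<open>W = V + 2 x\<close>.\<close>
    have "ln ((V + 2 * x) / W) \<le> (V + 2 * x) / W - 1"
      using V W x by (intro ln_le_minus_one) auto
    also have "\<dots> = 2 * ((x - s\<^sup>2 / 2) / W)" using W by (simp add: W_def field_simps)
    finally have "ln ((V + 2 * x) / W) \<le> 2 * ((x - s\<^sup>2 / 2) / W)" .
    moreover have "ln (1 + 2 * c) = ln ((V + 2 * x) / W) + ln (W / V)"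
    proof -
      have "1 + 2 * c = (V + 2 * x) / W * (W / V)" using V W(1) by (simp add: c_def field_simps)
      also have "ln \<dots> = ln ((V + 2 * x) / W) + ln (W / V)"
        using V W(1) x by (intro ln_mult_pos) auto
      finally show ?thesis .
    qed
    ultimately have k: "ln (1 + 2 * c) / 2 \<le> k" unfolding k_def by linarith
    \<comment> \<open>The claim at the minimising \<open>W\<close>, exponentiated; only
      \<open>c = x / V\<close> is left.\<close>
    have "1 \<le> (1 - p)\<^sup>2 * (1 + 2 * c)"
    proof -
      have pc: "p = c * (2 + c) / (2 * (1 + c)\<^sup>2)"
        using V x unfolding p_def c_def by (simp add: divide_simps) (simp add: algebra_simps power2_eq_square)
      have "(1 - p)\<^sup>2 * (1 + 2 * c) - 1 = c ^ 3 * (4 + 5 * c + 2 * c\<^sup>2) / (4 * (1 + c) ^ 4)"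
        using c unfolding pc by (simp add: divide_simps)
          (simp add: algebra_simps power2_eq_square power3_eq_cube power4_eq_xxxx)
      also have "\<dots> \<ge> 0" using c by simp
      finally show ?thesis by simp
    qed
    hence "0 \<le> ln ((1 - p)\<^sup>2 * (1 + 2 * c))" by simp
    also have "\<dots> = 2 * ln (1 - p) + ln (1 + 2 * c)"
      using p c by (subst ln_mult_pos) (auto simp: ln_realpow)
    finally show ?thesis using k by simp
  qed
  hence "0 \<le> v * (ln (1 - p) + k)" using v by simp
  moreover have "v * (ln (W / V) / 2 - s\<^sup>2 / (2 * W)) \<le> 1 * (ln (W / V) / 2 - s\<^sup>2 / (2 * W))"
    using v ln_ratio_ge by (intro mult_right_mono) auto
  moreover have "v * (ln (1 - p) + k) = v * ln (1 - p) + v * (x / W) + v * (ln (W / V) / 2 - s\<^sup>2 / (2 * W))"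
    by (simp add: k_def diff_divide_distrib algebra_simps)
  ultimately show ?thesis using tan by (simp add: v_def)
qed

text \<open>The tangent point \<open>x - s\<^sup>2\<close> satisfies
  \<open>W + (x - s\<^sup>2) = V + x\<close>, so the tangent has the denominators of
  \<open>p\<close> and \<open>a\<close>, and its corrections are polynomials in \<open>a\<close>,
  \<open>d\<close>, \<open>v\<close>, \<open>s\<close>.\<close>

lemma step_nonpos_large:
  assumes "u \<le> 0" "s\<^sup>2 \<le> x"
  shows "y\<^sup>2 / (2 * (W + y)) \<le> x\<^sup>2 / (2 * (V + x)) + ln (1 + u * p) + ln (W / V) / 2"
proof -
  define v where "v = - u"
  define d where "d = s\<^sup>2 / (V + x)"
  have v: "0 \<le> v" "v \<le> s" "v \<le> 1" using assms u s by (auto simp: v_def)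
  have v2: "v\<^sup>2 \<le> v" "v\<^sup>2 \<le> s\<^sup>2" using v by (auto simp: power2_eq_square mult_left_le intro: mult_mono)
  have d: "0 \<le> d" "d \<le> a" using V x assms by (auto simp: d_def a_def divide_right_mono)
  \<comment> \<open>The quadratic term uses \<open>a\<close> rather than \<open>p\<close>: the
    exponent is then at most \<open>v * a\<close> in size, so the remainder of
    \<open>exp_minus_le_quadratic\<close> is absorbed by that term.\<close>
  have "exp (- (v * p + v\<^sup>2 * a\<^sup>2 / 2)) \<le> 1 - v * p"
  proof -
    define t where "t = v * p + v\<^sup>2 * a\<^sup>2 / 2"
    have t0: "0 \<le> t" using v p by (simp add: t_def)
    have "t = v * (a - (1 - v) * a\<^sup>2 / 2)" by (simp add: t_def p_eq field_simps power2_eq_square)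
    also have "\<dots> \<le> v * a" using v by (intro mult_left_mono) auto
    finally have "t\<^sup>2 \<le> v\<^sup>2 * a\<^sup>2" using t0 power_mono[of t "v * a" 2] by (simp add: power_mult_distrib)
    thus ?thesis using exp_minus_le_quadratic[OF t0] by (simp add: t_def)
  qed
  moreover have vp: "0 < 1 - v * p" using up by (simp add: v_def)
  ultimately have ln1: "- v * p - v\<^sup>2 * a\<^sup>2 / 2 \<le> ln (1 - v * p)"
    by (subst ln_ge_iff) auto
  \<comment> \<open>Half of this bound cancels \<open>d / 2\<close> in the tangent and covers
    \<open>d\<^sup>2 * (1 - s\<^sup>2) / 4\<close>.\<close>
  have ln2: "d + d\<^sup>2 / 2 \<le> ln (W / V)"
  proof -
    have "ln (1 - d) \<le> - d - d\<^sup>2 / 2"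
      using ln_one_plus_quadratic_mono[of "- d" 0] d a by simp
    moreover have "V / W \<le> 1 - d"
    proof -
      have "1 - d - V / W = s\<^sup>2 * (x - s\<^sup>2) / (W * (V + x))"
        using V W x by (simp add: d_def divide_simps) (simp add: W_def algebra_simps)
      also have "\<dots> \<ge> 0" using V W x assms by simp
      finally show ?thesis by simp
    qed
    hence "ln (V / W) \<le> ln (1 - d)" using V W by (intro ln_mono) auto
    ultimately show ?thesis using V W by (simp add: ln_div)
  qed
  have "y\<^sup>2 / (2 * (W + y)) \<le> ((x - s\<^sup>2) ^ 3 + y\<^sup>2 * (2 * W + (x - s\<^sup>2))) / (4 * (W + (x - s\<^sup>2))\<^sup>2)"
    using W y assms by (intro tangent_bound) auto
  also have "\<dots> = x\<^sup>2 / (2 * (V + x)) - v * p - s\<^sup>2 * a\<^sup>2 / 2 + d / 2 + d\<^sup>2 * (1 - s\<^sup>2) / 4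
      - a * d / 4 * (1 + 2 * v - 3 * s\<^sup>2)"
  proof -
    define m where "m = V + x"
    have m: "m \<noteq> 0" "V = m - x" "u = - v" using V x by (auto simp: m_def v_def)
    show ?thesis unfolding y(2) W_def a_def p_def d_def m(2,3) using m(1)
      by (simp add: divide_simps) (simp add: algebra_simps power2_eq_square power3_eq_cube power4_eq_xxxx)
  qed
  finally have tan: "y\<^sup>2 / (2 * (W + y)) \<le> x\<^sup>2 / (2 * (V + x)) - v * p - s\<^sup>2 * a\<^sup>2 / 2 + d / 2
      + d\<^sup>2 * (1 - s\<^sup>2) / 4 - a * d / 4 * (1 + 2 * v - 3 * s\<^sup>2)" .
  have "d\<^sup>2 * (1 - s\<^sup>2) / 4 \<le> d\<^sup>2 / 4" by (simp add: mult_left_le)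
  \<comment> \<open>The last factor may be negative, but \<open>s\<^sup>2 \<le> 1\<close> and
    \<open>v\<^sup>2 \<le> v\<close> bound it below by \<open>- 2 * (s\<^sup>2 - v\<^sup>2)\<close>,
    and \<open>d \<le> a\<close> finishes.\<close>
  moreover have "- (s\<^sup>2 * a\<^sup>2 / 2) + v\<^sup>2 * a\<^sup>2 / 2 \<le> a * d / 4 * (1 + 2 * v - 3 * s\<^sup>2)"
  proof -
    have "a * d * (s\<^sup>2 - v\<^sup>2) \<le> a * a * (s\<^sup>2 - v\<^sup>2)"
      using a d v2 by (intro mult_right_mono mult_left_mono) auto
    moreover have "a * d * (- 2 * (s\<^sup>2 - v\<^sup>2)) \<le> a * d * (1 + 2 * v - 3 * s\<^sup>2)"
      using a d v2 s2 by (intro mult_left_mono) auto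
    ultimately show ?thesis by (simp add: algebra_simps power2_eq_square)
  qed
  ultimately have "y\<^sup>2 / (2 * (W + y)) \<le> x\<^sup>2 / (2 * (V + x)) + ln (1 - v * p) + ln (W / V) / 2"
    using tan ln1 ln2 by linarith
  thus ?thesis by (simp add: v_def)
qed

lemma step_exponent:
  "y\<^sup>2 / (2 * (W + y)) \<le> x\<^sup>2 / (2 * (V + x)) + ln (1 + u * p) + ln (W / V) / 2"
  using step_nonneg step_nonpos_small step_nonpos_large by linarith

lemma step:
  "exp (y\<^sup>2 / (2 * W + 2 * y)) / sqrt W \<le> (1 + u * p) * exp (x\<^sup>2 / (2 * V + 2 * x)) / sqrt V"
proof -
  have "exp (y\<^sup>2 / (2 * (W + y))) \<le> exp (x\<^sup>2 / (2 * (V + x)) + ln (1 + u * p) + ln (W / V) / 2)"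
    using step_exponent by simp
  also have "\<dots> = (1 + u * p) * exp (x\<^sup>2 / (2 * (V + x))) * (sqrt W / sqrt V)"
  proof -
    have "ln (W / V) / 2 = ln (sqrt W / sqrt V)"
      using V W by (simp add: ln_sqrt flip: real_sqrt_divide)
    thus ?thesis using up V W by (simp add: exp_add)
  qed
  finally show ?thesis using V W by (simp add: field_simps)
qed

end

section \<open>From scalars to vectors and arbitrary hints\<close>

text \<open>Dividing lengths by \<open>h\<close> and \<open>V\<close> by \<open>h\<^sup>2\<close>
  makes the hint \<open>1\<close>. The exponents and the linear term are invariant, and both square
  roots lose the same factor \<open>h\<close>.\<close>

lemma potential_step:
  fixes G v :: "'a :: real_inner" and V h :: real
  assumes V: "0 < V" and h: "0 < h" and v: "norm v \<le> h"
  shows "exp ((norm (G + v))\<^sup>2 / (2 * (V + (norm v)\<^sup>2) + 2 * h * norm (G + v))) / sqrt (V + (norm v)\<^sup>2)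
    \<le> (1 + (G \<bullet> v) * ((2 * V + h * norm G) / (2 * (V + h * norm G)\<^sup>2)))
       * exp ((norm G)\<^sup>2 / (2 * V + 2 * h * norm G)) / sqrt V"
proof -
  define X where "X = V / h\<^sup>2"
  define x where "x = norm G / h"
  define s where "s = norm v / h"
  \<comment> \<open>For \<open>G = 0\<close> this is \<open>0\<close> by division by zero, which is
    consistent since \<open>x = 0\<close> then.\<close>
  define u where "u = (G \<bullet> v) / (norm G * h)"
  define y where "y = norm (G + v) / h"
  interpret freegrad_step X x s u y "X + s\<^sup>2" "x * (2 * X + x) / (2 * (X + x)\<^sup>2)" "x / (X + x)"
  proof unfold_locales
    show "\<bar>u\<bar> \<le> s"
    proof (cases "G = 0")
      case False
      thus ?thesis using h Cauchy_Schwarz_ineq2[of G v]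
        by (simp add: u_def s_def abs_mult field_simps)
    qed (use h in \<open>simp add: u_def s_def\<close>)
    have "x * u * h\<^sup>2 = G \<bullet> v"
      using h by (cases "G = 0") (simp_all add: x_def u_def power2_eq_square)
    thus "y\<^sup>2 = x\<^sup>2 + 2 * x * u + s\<^sup>2"
      using h unfolding y_def x_def s_def power_divide dot_norm
      by (simp add: field_simps)
  qed (use assms in \<open>auto simp: X_def x_def s_def y_def divide_simps\<close>)
  have e: "(c / h)\<^sup>2 / (2 * (b / h\<^sup>2) + 2 * (c / h)) = c\<^sup>2 / (2 * b + 2 * h * c)" for b c
  proof -
    have "(c / h)\<^sup>2 / (2 * (b / h\<^sup>2) + 2 * (c / h)) = (c\<^sup>2 / h\<^sup>2) / ((2 * b + 2 * h * c) / h\<^sup>2)"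
      using h by (simp add: field_simps power2_eq_square)
    thus ?thesis using h by simp
  qed
  have Xs: "X + s\<^sup>2 = (V + (norm v)\<^sup>2) / h\<^sup>2"
    by (simp add: X_def s_def power_divide add_divide_distrib)
  have up: "u * (x * (2 * X + x) / (2 * (X + x)\<^sup>2))
      = (G \<bullet> v) * ((2 * V + h * norm G) / (2 * (V + h * norm G)\<^sup>2))"
  proof -
    have "u * x = (G \<bullet> v) / h\<^sup>2"
      using h by (cases "G = 0") (simp_all add: x_def u_def power2_eq_square)
    moreover have "X + x = (V + h * norm G) / h\<^sup>2" "2 * X + x = (2 * V + h * norm G) / h\<^sup>2"
      using h by (simp_all add: X_def x_def field_simps power2_eq_square)
    moreover have "(b / h\<^sup>2) * ((c / h\<^sup>2) / (2 * (d / h\<^sup>2)\<^sup>2)) = b * (c / (2 * d\<^sup>2))" for b c d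
      using h by (simp add: power_divide power2_eq_square)
    ultimately have "(u * x) * ((2 * X + x) / (2 * (X + x)\<^sup>2))
        = (G \<bullet> v) * ((2 * V + h * norm G) / (2 * (V + h * norm G)\<^sup>2))" by (simp only:)
    thus ?thesis by (simp only: times_divide_eq_right mult.assoc)
  qed
  have sq: "sqrt (b / h\<^sup>2) = sqrt b / h" for b using h by (simp add: real_sqrt_divide)
  have cancel: "b / (c / h) \<le> b' / (c' / h) \<longleftrightarrow> b / c \<le> b' / c'" for b b' c c'
    using h by (simp add: mult_le_cancel_right flip: times_divide_eq_left)
  show ?thesis
    using step unfolding up Xs unfolding X_def y_def x_def e sq cancel .
qed

section \<open>Descent of the potential over the rounds\<close>

lemma grad_sum_Suc: "grad_sum g (Suc n) = grad_sum g n + g (Suc n)"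
  by (simp add: grad_sum_def)

lemma grad_var_Suc: "grad_var g h (Suc n) = grad_var g h n + (norm (g (Suc n)))\<^sup>2"
  by (simp add: grad_var_def)

lemma cum_loss_Suc: "cum_loss g w (Suc n) = cum_loss g w n + g (Suc n) \<bullet> w (Suc n)"
  by (simp add: cum_loss_def)

lemma grad_var_pos: "h 1 > 0 \<Longrightarrow> grad_var g h n > 0"
  by (auto simp: grad_var_def intro!: add_pos_nonneg sum_nonneg)

text \<open>Raising the hint from \<open>h n\<close> to \<open>h (Suc n)\<close> only shrinks the
  exponential; \<open>potential_step\<close> then applies with the new hint. The guards
  \<open>0 < n\<close> are there because \<open>h 0\<close> is arbitrary.\<close>

lemma potential_Suc_le:
  assumes h1: "0 < h 1" and le: "h 1 \<le> h (Suc n)" "0 < n \<Longrightarrow> h n \<le> h (Suc n)"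
    and pos: "0 < n \<Longrightarrow> 0 < h n"
    and g: "norm (g (Suc n)) \<le> h (Suc n)" and w: "w (Suc n) = freegrad g h (Suc n)"
  shows "potential g h w (Suc n) \<le> potential g h w n"
proof -
  define G where "G = grad_sum g n"
  define V where "V = grad_var g h n"
  define k where "k = h (Suc n)"
  define v where "v = g (Suc n)"
  define E where "E = exp ((norm G)\<^sup>2 / (2 * V + 2 * k * norm G))"
  define D where "D = (2 * V + k * norm G) / (2 * (V + k * norm G)\<^sup>2)"
  have V: "0 < V" using grad_var_pos[of h] h1 by (simp add: V_def)
  have k: "0 < k" using h1 le by (simp add: k_def)
  \<comment> \<open>This loss cancels the linear term of \<open>potential_step\<close>.\<close>
  have gw: "v \<bullet> w (Suc n) = - ((h 1)\<^sup>2 * ((G \<bullet> v) * D * E / sqrt V))"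
    by (simp add: w freegrad_def Let_def G_def[symmetric] V_def[symmetric] k_def[symmetric]
        E_def D_def v_def inner_commute)
  have "(h 1)\<^sup>2 * (exp ((norm (G + v))\<^sup>2 / (2 * (V + (norm v)\<^sup>2) + 2 * k * norm (G + v))) / sqrt (V + (norm v)\<^sup>2))
      \<le> (h 1)\<^sup>2 * ((1 + (G \<bullet> v) * D) * E / sqrt V)"
    using potential_step[OF V k, of v G] g by (intro mult_left_mono) (auto simp: v_def k_def D_def E_def)
  hence "potential g h w (Suc n) \<le> cum_loss g w n + (h 1)\<^sup>2 * (E / sqrt V)"
    by (simp add: potential_def Let_def grad_sum_Suc grad_var_Suc cum_loss_Suc gw G_def[symmetric]
        V_def[symmetric] k_def[symmetric] v_def[symmetric] ring_distribs add_divide_distrib)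
  also have "\<dots> \<le> potential g h w n"
  proof -
    have "E \<le> exp ((norm G)\<^sup>2 / (2 * V + 2 * h n * norm G))"
    proof (cases "n = 0")
      \<comment> \<open>The empty sum makes both exponents vanish, whatever \<open>h 0\<close>
        is.\<close>
      case True
      thus ?thesis by (simp add: E_def G_def grad_sum_def)
    next
      case False
      thus ?thesis using V k le pos unfolding E_def exp_le_cancel_iff k_def
        by (intro divide_left_mono add_mono mult_right_mono mult_pos_pos add_pos_nonneg) auto
    qed
    hence "(h 1)\<^sup>2 * (E / sqrt V) \<le> (h 1)\<^sup>2 * (exp ((norm G)\<^sup>2 / (2 * V + 2 * h n * norm G)) / sqrt V)"
      using V by (intro mult_left_mono divide_right_mono) auto
    thus ?thesis by (simp add: potential_def Let_def G_def V_def)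
  qed
  finally show ?thesis .
qed

theorem theorem5:
  fixes g :: "nat \<Rightarrow> real ^ 'd"
    and H :: "(nat \<Rightarrow> real ^ 'd) \<Rightarrow> nat \<Rightarrow> real"
    and h :: "nat \<Rightarrow> real"
    and w :: "nat \<Rightarrow> real ^ 'd"
    and T :: nat
  assumes "norm (g 1) > 0"
    and "\<And>t. t \<ge> 1 \<Longrightarrow> h t = H g t"
    and "hints_scale_with H g"
    and "mono_on {1..} h"
    and "\<And>t. t \<ge> 1 \<Longrightarrow> h t \<ge> max_norm g t"
    and "\<And>t. t \<ge> 1 \<Longrightarrow> w t = freegrad g h t"
    and "T \<ge> 1"
  shows "(\<forall>t\<in>{1..T}. potential g h w t \<le> potential g h w (t - 1)) \<and> potential g h w 0 = h 1"
proof -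
  have norm_le: "norm (g t) \<le> h t" if "t \<ge> 1" for t
  proof -
    have "norm (g t) \<le> max_norm g t" unfolding max_norm_def using that by (intro Max_ge) auto
    thus ?thesis using assms(5)[OF that] by simp
  qed
  \<comment> \<open>This makes \<open>grad_var\<close> positive from time \<open>0\<close> on and,
    by monotonicity, every later hint positive.\<close>
  have h1: "0 < h 1" using norm_le[of 1] assms(1) by linarith
  have mono: "h i \<le> h j" if "1 \<le> i" "i \<le> j" for i j
    using mono_onD[OF assms(4)] that by simp
  have "potential g h w (Suc n) \<le> potential g h w n" for n
    using h1 mono[of 1 n] mono[of 1 "Suc n"] mono[of n "Suc n"] norm_le assms(6)
    by (intro potential_Suc_le) auto
  hence "potential g h w t \<le> potential g h w (t - 1)" if "t \<in> {1..T}" for t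
    using that by (cases t) auto
  moreover have "potential g h w 0 = h 1"
    using h1 by (simp add: potential_def Let_def cum_loss_def grad_sum_def grad_var_def power2_eq_square)
  ultimately show ?thesis by blast
qed

end
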